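(* Let $\mathbb{Q}^+$ be the set of positive rational numbers, each written as $a/b$ in lowest terms with $a,b$ coprime positive integers. Define $w:\mathbb{Q}^+\to\mathbb{N}$ by $w(a/b)=a+b$, and $\theta:\mathbb{Q}^+\setminus\{1/1\}\to\mathbb{Q}^+$ by $$\theta\left(\frac{a}{b}\right)=\begin{cases}\dfrac{a-b}{b}, & a>b,\\[4pt] \dfrac{b-a}{a}, & a<b \text{ and } b \text{ even},\\[4pt] \dfrac{a}{b-a}, & a<b \text{ and } b \text{ odd}.\end{cases}$$ Then $w(\theta(x))<w(x)$ for all $x\in\mathbb{Q}^+\setminus\{1/1\}$, and the rooted tree with root $1/1$ in which the parent of each node $x\neq 1/1$ is $\theta(x)$ (equivalently, the tree built from the root $1/1$ by attaching to each node $x$ the elements of $\theta^{-1}(x)$ as its children) is a rational tree: every positive rational number appears in it exactly once.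
   Context: A rational tree is a rooted tree whose nodes are labeled by $\mathbb{Q}^+$ such that every positive rational number appears exactly once and the children of each node are given by an explicit rule. The map $\theta$ is the composition, with respect to the partition of $\mathbb{Q}^+$ by the parity of the denominator, of the parent maps of the Kepler tree and of the Calkin–Wilf tree. *)

theory Defs
  imports "HOL-Library.FuncSet" "Graph_Theory.Graph_Theory"
begin

abbreviation pos_rats :: "rat set" where
  "pos_rats \<equiv> {0<..}"

definition w :: "rat \<Rightarrow> nat" where
  "w x = (case quotient_of x of (a, b) \<Rightarrow> nat (a + b))"

text \<open>Only the values on \<open>pos_rats - {1}\<close> matter.\<close>

definition theta :: "rat \<Rightarrow> rat" where
  "theta x = (case quotient_of x of (a, b) \<Rightarrow>
     if a > b then Fract (a - b) b
     else if a < b \<and> even b then Fract (b - a) a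
     else if a < b \<and> odd b then Fract a (b - a)
     else undefined)"

definition theta_children :: "rat \<Rightarrow> rat set" where
  "theta_children x = {y \<in> pos_rats - {1}. theta y = x}"

text \<open>
  Rooted trees have arcs directed from parent to child and may be infinite.  The predicate
  \<open>Digraph_Component.tree\<close> is not used because its acyclicity condition only excludes
  directed cycles.
\<close>

definition rooted_tree :: "('v, 'e) pre_digraph \<Rightarrow> 'v \<Rightarrow> bool" where
  "rooted_tree T r \<longleftrightarrow>
     wf_digraph T \<and> r \<in> verts T \<and> (\<forall>v \<in> verts T. \<exists>!p. pre_digraph.awalk T r p v)"

text \<open>
  \<open>lab\<close> gives the label of a node, and \<open>C q\<close> the labels that the rule prescribes for the
  children of a node labelled \<open>q\<close>.  Since \<open>lab\<close> is injective on the nodes, distinct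
  children have distinct labels.
\<close>

definition rational_tree ::
    "('v, 'e) pre_digraph \<Rightarrow> 'v \<Rightarrow> ('v \<Rightarrow> rat) \<Rightarrow> (rat \<Rightarrow> rat set) \<Rightarrow> bool" where
  "rational_tree T r lab C \<longleftrightarrow>
     rooted_tree T r \<and>
     bij_betw lab (verts T) pos_rats \<and>
     (\<forall>v \<in> verts T. lab ` {u. v \<rightarrow>\<^bsub>T\<^esub> u} = C (lab v))"

definition parent_graph :: "'a set \<Rightarrow> 'a \<Rightarrow> ('a \<Rightarrow> 'a) \<Rightarrow> ('a, 'a \<times> 'a) pre_digraph" where
  "parent_graph V r f = with_proj \<lparr> pverts = V, parcs = {(f x, x) | x. x \<in> V - {r}} \<rparr>"

text \<open>
  The tree grown from a root labelled \<open>r\<close> by attaching to each node labelled \<open>x\<close> one new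
  child for each element of \<open>C x\<close>.  A node is represented by the list of labels on the path
  from the root to it, so that its own label is the last entry and the same label can occur
  at several nodes.
\<close>

inductive_set grown_nodes :: "'a \<Rightarrow> ('a \<Rightarrow> 'a set) \<Rightarrow> 'a list set"
  for r :: 'a and C :: "'a \<Rightarrow> 'a set" where
  root: "[r] \<in> grown_nodes r C"
| child: "xs \<in> grown_nodes r C \<Longrightarrow> y \<in> C (last xs) \<Longrightarrow> xs @ [y] \<in> grown_nodes r C"

definition grown_tree :: "'a \<Rightarrow> ('a \<Rightarrow> 'a set) \<Rightarrow> ('a list, 'a list \<times> 'a list) pre_digraph" where
  "grown_tree r C = with_proj
     \<lparr> pverts = grown_nodes r C,
       parcs = {(xs, xs @ [y]) | xs y. xs \<in> grown_nodes r C \<and> y \<in> C (last xs)} \<rparr>"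

end

theory Submission
  imports Defs
begin

text \<open>
  Numerator and denominator of \<open>theta x\<close> come out of the defining rule already in lowest terms,
  so \<open>w\<close> can be read off and strictly decreases.  Iterating \<open>theta\<close> therefore leads from every
  positive rational to 1, which gives existence of the path from the root; it is unique because
  every node has only one parent.  The grown tree is itself the parent graph of \<open>butlast\<close>, ranked
  by length, and both existence and uniqueness of the node with a given label follow by
  descending along \<open>theta\<close>.
\<close>

text \<open>\<open>cas\<close> recurses on the first arc, but in a parent graph it is the last arc
  of a walk that is forced by its end vertex; hence the decomposition at the end.\<close>

lemma (in pre_digraph) cas_snoc:
  "cas u (p @ [e]) v \<longleftrightarrow> cas u p (tail G e) \<and> head G e = v"
  by (induction p arbitrary: u) auto

lemma (in pre_digraph) awalk_snoc:
  "awalk u (p @ [e]) v \<longleftrightarrow> awalk u p (tail G e) \<and> e \<in> arcs G \<and> head G e = v"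
  unfolding awalk_def cas_snoc by auto

lemma verts_parent_graph [simp]: "verts (parent_graph V r f) = V"
  by (simp add: parent_graph_def)

lemma dominates_parent_graph:
  "u \<rightarrow>\<^bsub>parent_graph V r f\<^esub> v \<longleftrightarrow> v \<in> V - {r} \<and> f v = u"
  by (auto simp: parent_graph_def)

lemma awalk_parent_graph_snoc:
  "pre_digraph.awalk (parent_graph V r f) u (p @ [e]) v \<longleftrightarrow>
     pre_digraph.awalk (parent_graph V r f) u p (f v) \<and> v \<in> V - {r} \<and> e = (f v, v)"
  by (auto simp: pre_digraph.awalk_snoc parent_graph_def)

lemma awalk_parent_graph_Nil:
  "pre_digraph.awalk (parent_graph V r f) u [] v \<longleftrightarrow> u \<in> V \<and> u = v"
  by (auto simp: pre_digraph.awalk_def pre_digraph.cas.simps)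

text \<open>The rank \<open>m\<close> makes iteration of \<open>f\<close> terminate, and it can only
  stop at \<open>r\<close>. It serves twice: with \<open>w\<close> on the rationals and with
  \<open>length\<close> on paths.\<close>

lemma rooted_tree_parent_graph:
  fixes m :: "'a \<Rightarrow> nat"
  assumes "r \<in> V"
    and closed: "\<And>x. x \<in> V - {r} \<Longrightarrow> f x \<in> V"
    and descent: "\<And>x. x \<in> V - {r} \<Longrightarrow> m (f x) < m x"
  shows "rooted_tree (parent_graph V r f) r"
proof -
  let ?G = "parent_graph V r f"
  have "wf_digraph ?G"
    using closed by unfold_locales (auto simp: parent_graph_def)
  moreover have "\<exists>!p. pre_digraph.awalk ?G r p v" if "v \<in> V" for v
    using that
  proof (induction "m v" arbitrary: v rule: less_induct)
    case less
    show ?case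
    proof (cases "v = r")
      case True
      \<comment> \<open>No arc ends in \<open>r\<close>, so a nonempty walk cannot return
        there.\<close>
      have "pre_digraph.awalk ?G r p v \<longleftrightarrow> p = []" for p
        using True \<open>r \<in> V\<close>
        by (cases p rule: rev_cases) (auto simp: awalk_parent_graph_snoc awalk_parent_graph_Nil)
      then show ?thesis by simp
    next
      case False
      then have "v \<in> V - {r}" using less.prems by simp
      \<comment> \<open>Unique existence at the parent, recast as an equivalence: \<open>q\<close>
        fixes all but the last arc of a walk to \<open>v\<close>.\<close>
      then obtain q where q: "\<And>p. pre_digraph.awalk ?G r p (f v) \<longleftrightarrow> p = q"
        using less.hyps[of "f v"] closed descent by metis
      have "pre_digraph.awalk ?G r p v \<longleftrightarrow> p = q @ [(f v, v)]" for p
        using \<open>v \<in> V - {r}\<close> q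
        by (cases p rule: rev_cases) (auto simp: awalk_parent_graph_snoc awalk_parent_graph_Nil)
      then show ?thesis by simp
    qed
  qed
  ultimately show ?thesis
    using \<open>r \<in> V\<close> by (simp add: rooted_tree_def)
qed

lemma grown_nodes_nonempty: "xs \<in> grown_nodes r C \<Longrightarrow> xs \<noteq> []"
  by (induction rule: grown_nodes.induct) auto

lemma butlast_grown_nodes:
  "xs \<in> grown_nodes r C \<Longrightarrow> xs \<noteq> [r] \<Longrightarrow>
     butlast xs \<in> grown_nodes r C \<and> last xs \<in> C (last (butlast xs))"
  by (auto elim: grown_nodes.cases)

lemma grown_tree_eq_parent_graph:
  "grown_tree r C = parent_graph (grown_nodes r C) [r] butlast"
proof -
  have "{(xs, xs @ [y]) | xs y. xs \<in> grown_nodes r C \<and> y \<in> C (last xs)} =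
      {(butlast xs, xs) | xs. xs \<in> grown_nodes r C - {[r]}}"
    (is "?A = ?B")
  proof (intro equalityI subsetI)
    fix e assume "e \<in> ?A"
    then obtain xs y where "e = (xs, xs @ [y])" "xs \<in> grown_nodes r C" "y \<in> C (last xs)"
      by blast
    \<comment> \<open>Since \<open>xs\<close> is nonempty, \<open>xs @ [y]\<close> has at least two
      entries and so differs from \<open>[r]\<close>.\<close>
    then show "e \<in> ?B"
      using grown_nodes.child grown_nodes_nonempty by fastforce
  next
    fix e assume "e \<in> ?B"
    then obtain xs where xs: "e = (butlast xs, xs)" "xs \<in> grown_nodes r C" "xs \<noteq> [r]"
      by blast
    then have "e = (butlast xs, butlast xs @ [last xs])"
      using grown_nodes_nonempty by fastforce
    then show "e \<in> ?A"
      using butlast_grown_nodes[OF xs(2,3)] by blast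
  qed
  then show ?thesis
    by (simp add: grown_tree_def parent_graph_def)
qed

text \<open>This holds for an arbitrary rule \<open>C\<close>, even one that repeats labels, because
  nodes are paths and not labels.\<close>

lemma rooted_tree_grown_tree: "rooted_tree (grown_tree r C) [r]"
  unfolding grown_tree_eq_parent_graph
proof (rule rooted_tree_parent_graph[where m = length])
  show "[r] \<in> grown_nodes r C" by (rule grown_nodes.root)
  show "butlast xs \<in> grown_nodes r C" if "xs \<in> grown_nodes r C - {[r]}" for xs
    using that by (simp add: butlast_grown_nodes)
  show "length (butlast xs) < length xs" if "xs \<in> grown_nodes r C - {[r]}" for xs
    using that grown_nodes_nonempty[of xs r C] by simp
qed

lemma verts_grown_tree: "verts (grown_tree r C) = grown_nodes r C"
  by (simp add: grown_tree_def)

lemma last_children_grown_tree: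
  assumes "xs \<in> grown_nodes r C"
  shows "last ` {ys. xs \<rightarrow>\<^bsub>grown_tree r C\<^esub> ys} = C (last xs)"
proof -
  have "{ys. xs \<rightarrow>\<^bsub>grown_tree r C\<^esub> ys} = (\<lambda>y. xs @ [y]) ` C (last xs)"
    using assms by (auto simp: grown_tree_def)
  then show ?thesis by (simp add: image_image)
qed

text \<open>Surjectivity follows the descent of \<open>m\<close> to the root and appends labels on
  the way back. Injectivity is induction on the path: a label \<open>y\<close> other than
  \<open>r\<close> lies only in \<open>C (f y)\<close>, so it determines the label before
  it.\<close>

lemma bij_betw_last_grown_nodes:
  fixes m :: "'a \<Rightarrow> nat"
  assumes "r \<in> V"
    and closed: "\<And>x. x \<in> V - {r} \<Longrightarrow> f x \<in> V"
    and descent: "\<And>x. x \<in> V - {r} \<Longrightarrow> m (f x) < m x"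
    and C: "\<And>x. C x = {y \<in> V - {r}. f y = x}"
  shows "bij_betw last (grown_nodes r C) V"
proof -
  have "last xs \<in> V" if "xs \<in> grown_nodes r C" for xs
    using that by cases (auto simp: C \<open>r \<in> V\<close>)
  moreover have "\<exists>xs \<in> grown_nodes r C. last xs = v" if "v \<in> V" for v
    using that
  proof (induction "m v" arbitrary: v rule: less_induct)
    case less
    show ?case
    proof (cases "v = r")
      case True
      then show ?thesis using grown_nodes.root[of r C] by force
    next
      case False
      then have v: "v \<in> V - {r}" using less.prems by simp
      then obtain xs where "xs \<in> grown_nodes r C" "last xs = f v"
        using less.hyps closed descent by blast
      then show ?thesis
        using v grown_nodes.child[of xs r C v] by (force simp: C)
    qed
  qed
  moreover have "xs = ys"
    if "xs \<in> grown_nodes r C" "ys \<in> grown_nodes r C" "last xs = last ys" for xs ys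
    using that
  proof (induction arbitrary: ys)
    case root
    \<comment> \<open>No \<open>C x\<close> contains \<open>r\<close>, so a node labelled
      \<open>r\<close> must be \<open>[r]\<close>.\<close>
    then show ?case by (auto simp: C elim: grown_nodes.cases)
  next
    case (child xs y)
    \<comment> \<open>The case split is on \<open>ys\<close>: it cannot be \<open>[r]\<close>, and
      otherwise its parent has label \<open>f y\<close>, as \<open>xs\<close> has, so the induction
      hypothesis applies.\<close>
    from child.prems(1) child.hyps child.prems(2) child.IH show ?case
      by cases (auto simp: C)
  qed
  ultimately show ?thesis
    by (auto simp: bij_betw_def inj_on_def)
qed

lemma quotient_of_Fract_coprime:
  "b > 0 \<Longrightarrow> coprime a b \<Longrightarrow> quotient_of (Fract a b) = (a, b)"
  by (simp add: quotient_of_Fract normalize_def)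

lemma w_Fract: "b > 0 \<Longrightarrow> coprime a b \<Longrightarrow> w (Fract a b) = nat (a + b)"
  by (simp add: w_def quotient_of_Fract_coprime)

text \<open>The sum of the entries drops from \<open>a + b\<close> to the larger of \<open>a\<close>
  and \<open>b\<close>; the parity of \<open>b\<close> only chooses between a fraction and its
  reciprocal, which have the same sum.\<close>

lemma theta_pos_and_w_less:
  assumes "x \<in> pos_rats - {1}"
  shows "theta x \<in> pos_rats \<and> w (theta x) < w x"
proof -
  obtain a b where q: "quotient_of x = (a, b)"
    by fastforce
  have b: "b > 0" and cop: "coprime a b" and x: "x = Fract a b"
    using quotient_of_denom_pos[OF q] quotient_of_coprime[OF q] Fract_quotient_of[of x] q
    by auto
  have a: "a > 0"
    using assms b x by (simp add: zero_less_Fract_iff)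
  have "a \<noteq> b"
    using assms b x by (auto simp: One_rat_def eq_rat)
  \<comment> \<open>One pair for each branch of \<open>theta\<close>; subtracting one entry from the
    other preserves the gcd.\<close>
  have cops: "coprime (a - b) b" "coprime (b - a) a" "coprime a (b - a)"
    using cop gcd_diff1[of a b] gcd_diff1[of b a] gcd.commute[of a "b - a"] gcd.commute[of b a]
    unfolding coprime_iff_gcd_eq_1 by metis+
  have wx: "w x = nat (a + b)"
    by (simp add: w_def q)
  consider "a > b" | "a < b" "even b" | "a < b" "odd b"
    using \<open>a \<noteq> b\<close> by linarith
  then show ?thesis
    by cases (use a b cops wx in \<open>auto simp: theta_def q w_Fract zero_less_Fract_iff\<close>)
qed

theorem theorem21:
  shows "theta \<in> pos_rats - {1} \<rightarrow> pos_rats \<and>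
    (\<forall>x \<in> pos_rats - {1}. w (theta x) < w x) \<and>
    rational_tree (parent_graph pos_rats 1 theta) 1 (\<lambda>x. x) theta_children \<and>
    rational_tree (grown_tree 1 theta_children) [1] last theta_children"
proof (intro conjI)
  have closed: "theta x \<in> pos_rats" and descent: "w (theta x) < w x"
    if "x \<in> pos_rats - {1}" for x
    using theta_pos_and_w_less[OF that] by blast+
  have one: "1 \<in> pos_rats" by simp
  show "theta \<in> pos_rats - {1} \<rightarrow> pos_rats"
    using closed by blast
  show "\<forall>x \<in> pos_rats - {1}. w (theta x) < w x"
    using descent by blast
  show "rational_tree (parent_graph pos_rats 1 theta) 1 (\<lambda>x. x) theta_children"
    using rooted_tree_parent_graph[of 1 pos_rats theta w, OF one closed descent]
    by (auto simp: rational_tree_def dominates_parent_graph theta_children_def bij_betw_def)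
  have "bij_betw last (grown_nodes 1 theta_children) pos_rats"
    by (rule bij_betw_last_grown_nodes[where m = w, OF one closed descent]) (simp_all add: theta_children_def)
  then show "rational_tree (grown_tree 1 theta_children) [1] last theta_children"
    using last_children_grown_tree[of _ 1 theta_children]
    by (simp add: rational_tree_def rooted_tree_grown_tree verts_grown_tree)
qed

end
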